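(* Let $$\lambda^*=6\,\frac{\theta_3^*-\sin\theta_3^*}{(\theta_3^* )^3}=0.4466\ldots.$$ For $3/8<\lambda\leq\lambda^*$ let $\theta_3(\lambda)\in(0,2\pi)$ denote the unique root (which exists) of the equation $$2\cos x\,(\lambda x^4-18x^2+36)-6x\sin x\,(x^2(\lambda+1)-12)-(3-4\lambda)x^4-72=0,\qquad x\in(0,2\pi),$$ and let $\theta_3(\lambda)=0$ for $0\leq\lambda\leq3/8$. Then $\theta_3(\lambda^* )=\theta_3^*$, $q_3(\lambda)=1-\lambda$ for $0\leq\lambda\leq3/8$, and $$q_3(\lambda)=\frac{6}{x^3}\sqrt{\Big(\cos x-1+\frac{x^2}{2}\Big)^2+\Big(\sin x-x+\frac{\lambda x^3}{6}\Big)^2}\,\bigg|_{x=\theta_3(\lambda)},\qquad \frac38<\lambda\leq\lambda^*.$$ Moreover, the function $\lambda+q_3(\lambda)$ is strictly increasing for $3/8<\lambda\leq\lambda^*$, and the function $q_3(\lambda)$ is strictly decreasing for $0\leq\lambda\leq\lambda^*$. In particular, $$q_3(3/8)=5/8,\qquad \inf_{\lambda\geq0}q_3(\lambda)=q_3(\lambda^* )=6\varkappa_3=0.594971\ldots.$$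
   Context: For $\lambda\geq0$, $$q_3(\lambda)=\sup_{x>0}\frac{3!}{x^3}\bigg|e^{ix}-\sum_{k=0}^{2}\frac{(ix)^k}{k!}-\lambda\frac{(ix)^3}{3!}\bigg|.$$ The number $\theta_3^*=3.9958\ldots$ is the unique root of the equation $x^2+2x\sin x+6(\cos x-1)=0$ in $x\in(0,2\pi)$, and $$\varkappa_3=\sup_{x>0}\frac{\cos x-1+x^2/2}{x^3}.$$ *)

theory Defs
  imports "HOL-Analysis.Analysis"
begin

definition q3 :: "real \<Rightarrow> real" where
  "q3 lam = (SUP x\<in>{0<..}. fact 3 / x ^ 3 *
     cmod (exp (\<i> * of_real x) - (\<Sum>k=0..2. (\<i> * of_real x) ^ k / fact k)
           - of_real lam * ((\<i> * of_real x) ^ 3 / fact 3)))"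

definition kappa3 :: real where
  "kappa3 = (SUP x\<in>{0<..}. (cos x - 1 + x ^ 2 / 2) / x ^ 3)"

definition theta3_star :: real where
  "theta3_star = (THE x. x \<in> {0<..<2 * pi} \<and> x ^ 2 + 2 * x * sin x + 6 * (cos x - 1) = 0)"

definition lam_star :: real where
  "lam_star = 6 * (theta3_star - sin theta3_star) / theta3_star ^ 3"

definition theta3_lhs :: "real \<Rightarrow> real \<Rightarrow> real" where
  "theta3_lhs lam x =
     2 * cos x * (lam * x ^ 4 - 18 * x ^ 2 + 36)
     - 6 * x * sin x * (x ^ 2 * (lam + 1) - 12)
     - (3 - 4 * lam) * x ^ 4 - 72"

text \<open>Only the values for \<open>0 \<le> lam \<le> lam_star\<close> are meaningful.\<close>

definition theta3 :: "real \<Rightarrow> real" where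
  "theta3 lam = (if lam \<le> 3 / 8 then 0
     else (THE x. x \<in> {0<..<2 * pi} \<and> theta3_lhs lam x = 0))"

text \<open>The two suprema are real-valued and the first unique root exists, so that
  \<open>SUP\<close> and \<open>THE\<close> above do not take unspecified values.\<close>

lemma exp_i_remainder_bound:
  fixes x :: real
  assumes "x > 0"
  shows "cmod (exp (\<i> * of_real x) - (\<Sum>k=0..2. (\<i> * of_real x) ^ k / fact k)) \<le> x ^ 3 / 2"
proof -
  have "cmod (exp (\<i> * of_real x) - (\<Sum>k\<le>2. (\<i> * of_real x) ^ k / fact k))
      \<le> exp \<bar>Re (\<i> * of_real x)\<bar> * cmod (\<i> * of_real x) ^ Suc 2 / fact 2"
    by (rule Taylor_exp)
  then show ?thesis
    using assms by (simp add: norm_mult atMost_atLeast0 eval_nat_numeral)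
qed

lemma bdd_above_q3:
  "bdd_above ((\<lambda>x::real. fact 3 / x ^ 3 *
     cmod (exp (\<i> * of_real x) - (\<Sum>k=0..2. (\<i> * of_real x) ^ k / fact k)
           - of_real lam * ((\<i> * of_real x) ^ 3 / fact 3))) ` {0<..})"
proof (rule bdd_aboveI2)
  fix x :: real assume "x \<in> {0<..}"
  then have x: "x > 0" by simp
  let ?R = "exp (\<i> * of_real x) - (\<Sum>k=0..2. (\<i> * of_real x) ^ k / fact k)"
  let ?L = "of_real lam * ((\<i> * of_real x) ^ 3 / fact 3) :: complex"
  have "cmod ?L = \<bar>lam\<bar> * x ^ 3 / 6"
    using x by (simp add: norm_mult norm_divide norm_power fact_numeral)
  then have "cmod (?R - ?L) \<le> x ^ 3 / 2 + \<bar>lam\<bar> * x ^ 3 / 6"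
    using norm_triangle_ineq4[of ?R ?L] exp_i_remainder_bound[OF x] by linarith
  then have "6 / x ^ 3 * cmod (?R - ?L) \<le> 6 / x ^ 3 * (x ^ 3 / 2 + \<bar>lam\<bar> * x ^ 3 / 6)"
    using x by (intro mult_left_mono) auto
  also have "\<dots> = 3 + \<bar>lam\<bar>"
    using x by (simp add: field_simps)
  finally show "fact 3 / x ^ 3 * cmod (?R - ?L) \<le> 3 + \<bar>lam\<bar>"
    by (simp add: fact_numeral)
qed

lemma bdd_above_kappa3:
  "bdd_above ((\<lambda>x::real. (cos x - 1 + x ^ 2 / 2) / x ^ 3) ` {0<..})"
proof (rule bdd_aboveI2)
  fix x :: real assume "x \<in> {0<..}"
  then have x: "x > 0" by simp
  let ?R = "exp (\<i> * of_real x) - (\<Sum>k=0..2. (\<i> * of_real x) ^ k / fact k)"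
  have "Re ?R = cos x - 1 + x ^ 2 / 2"
    by (simp add: numeral_2_eq_2 Re_exp)
  then have "cos x - 1 + x ^ 2 / 2 \<le> x ^ 3 / 2"
    using complex_Re_le_cmod[of ?R] exp_i_remainder_bound[OF x] by linarith
  then show "(cos x - 1 + x ^ 2 / 2) / x ^ 3 \<le> 1 / 2"
    using x by (simp add: field_simps)
qed

lemma theta3_star_ex1:
  "\<exists>!x. x \<in> {0<..<2 * pi} \<and> x ^ 2 + 2 * x * sin x + 6 * (cos x - 1) = (0::real)"
proof -
  define g :: "real \<Rightarrow> real" where "g x = x ^ 2 + 2 * x * sin x + 6 * (cos x - 1)" for x
  define g' :: "real \<Rightarrow> real" where
    "g' x = 8 * cos (x / 2) * (x / 2 * cos (x / 2) - sin (x / 2))" for x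
  have der: "(g has_real_derivative g' x) (at x)" for x
  proof -
    have "(g has_real_derivative 2 * x * (1 + cos x) - 4 * sin x) (at x)"
      unfolding g_def by (auto intro!: derivative_eq_intros simp: algebra_simps)
    moreover have "2 * x * (1 + cos x) - 4 * sin x = g' x"
      using cos_double_cos[of "x / 2"] sin_double[of "x / 2"]
      by (simp add: g'_def power2_eq_square algebra_simps)
    ultimately show ?thesis by simp
  qed
  have neg: "u * cos u - sin u < 0" if "0 < u" "u < pi" for u :: real
  proof -
    have "u * cos u - sin u < 0 * cos 0 - sin 0"
    proof (rule DERIV_neg_imp_decreasing_open[OF that(1)])
      fix v assume "0 < v" "v < u"
      then have "sin v > 0" using that by (intro sin_gt_zero) auto
      moreover have "((\<lambda>u. u * cos u - sin u) has_real_derivative - (v * sin v)) (at v)"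
        by (auto intro!: derivative_eq_intros)
      ultimately show "\<exists>y. ((\<lambda>u. u * cos u - sin u) has_real_derivative y) (at v) \<and> y < 0"
        using \<open>0 < v\<close> by (intro exI[of _ "- (v * sin v)"]) auto
    qed (auto intro!: continuous_intros)
    then show ?thesis by simp
  qed
  have cont: "continuous_on S g" for S
    unfolding g_def by (auto intro!: continuous_intros)
  have dec: "g b < 0" if "0 < b" "b \<le> pi" for b
  proof -
    have "g b < g 0"
    proof (rule DERIV_neg_imp_decreasing_open[OF that(1)])
      fix x assume "0 < x" "x < b"
      then have "g' x < 0"
        using that neg[of "x / 2"] cos_gt_zero_pi[of "x / 2"]
        by (auto simp: g'_def mult_less_0_iff)
      then show "\<exists>y. (g has_real_derivative y) (at x) \<and> y < 0" using der by blast
    qed (rule cont)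
    then show ?thesis by (simp add: g_def)
  qed
  have inc: "g a < g b" if "pi \<le> a" "a < b" "b \<le> 2 * pi" for a b
  proof (rule DERIV_pos_imp_increasing_open[OF that(2)])
    fix x assume "a < x" "x < b"
    then have x: "pi < x" "x < 2 * pi" using that by auto
    have "cos (x / 2) < cos (pi / 2)"
      using x by (intro cos_monotone_0_pi) auto
    then have "cos (x / 2) < 0" by simp
    then have "g' x > 0"
      using neg[of "x / 2"] x pi_gt_zero by (auto simp: g'_def zero_less_mult_iff)
    then show "\<exists>y. (g has_real_derivative y) (at x) \<and> y > 0" using der by blast
  qed (rule cont)
  have end_pos: "g (2 * pi) > 0" by (simp add: g_def)
  obtain x where x: "pi \<le> x" "x \<le> 2 * pi" "g x = 0"
    using IVT'[of g pi 0 "2 * pi"] dec[of pi] end_pos cont by auto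
  then have x': "x < 2 * pi" using end_pos by (cases "x = 2 * pi") auto
  have "\<exists>!x. x \<in> {0<..<2 * pi} \<and> g x = 0"
  proof (rule ex1I[of _ x])
    show "x \<in> {0<..<2 * pi} \<and> g x = 0" using x x' pi_gt_zero by auto
  next
    fix y assume y: "y \<in> {0<..<2 * pi} \<and> g y = 0"
    then have "pi \<le> y" using dec[of y] by (cases "y \<le> pi") auto
    then show "y = x" using inc[of y x] inc[of x y] x y by (cases y x rule: linorder_cases) auto
  qed
  then show ?thesis by (simp add: g_def)
qed

end

theory Submission
  imports Defs "HOL-Real_Asymp.Real_Asymp"
begin

text \<open>
  With \<open>a(x) = 6 (cos x - 1 + x\<^sup>2/2) / x\<^sup>3\<close> and \<open>b(x) = 6 (x - sin x) / x\<^sup>3\<close>, the number \<open>q3 lam\<close>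
  is the supremum of \<open>sqrt (a\<^sup>2 + (b - lam)\<^sup>2)\<close>. The derivative in \<open>x\<close> of the radicand is
  \<open>12 D / x\<^sup>4 * (lam - h(x))\<close>, where \<open>D(x) = 2 x + x cos x - 3 sin x > 0\<close>,
  \<open>h = M / (2 x\<^sup>3 D)\<close> and \<open>M = - theta3_lhs 0\<close>. The key point is that \<open>M' = 6 x\<^sup>2 D\<close>, so that by
  the monotone form of l'Hospital's rule \<open>h\<close> increases on \<open>(0, 2 pi)\<close> as soon as \<open>x D' / D\<close>
  decreases, hence as soon as \<open>x D'' / D'\<close> decreases. With \<open>u = x / 2\<close> the latter equals
  \<open>u cot u + u\<^sup>2 sin u / (sin u - u cos u)\<close>, and the same rule reduces the second summand to
  \<open>2 + u cot u\<close>. Since \<open>h\<close> starts at \<open>3/8\<close>, the radicand decreases for \<open>lam \<le> 3/8\<close> and is unimodal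
  with maximum at \<open>theta3 lam\<close> for larger \<open>lam\<close>; for \<open>x \<ge> 2 pi\<close> a crude estimate suffices.
  At \<open>theta3_star\<close> the function \<open>a\<close> is critical, so that \<open>h = b = lam_star\<close> there.
\<close>

subsection \<open>The monotone form of l'Hospital's rule\<close>

text \<open>Cauchy's mean value theorem gives \<open>p x / q x = p' z / q' z\<close> for some
  \<open>z < x\<close>, which is below \<open>p' x / q' x\<close>. This is the positivity of the
  numerator of the derivative of \<open>p / q\<close>.\<close>

lemma monotone_quotient:
  fixes p q p' q' :: "real \<Rightarrow> real"
  assumes p: "\<And>x. a \<le> x \<Longrightarrow> x < c \<Longrightarrow> (p has_real_derivative p' x) (at x)"
    and q: "\<And>x. a \<le> x \<Longrightarrow> x < c \<Longrightarrow> (q has_real_derivative q' x) (at x)"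
    and zero: "p a = 0" "q a = 0"
    and q'_pos: "\<And>x. a < x \<Longrightarrow> x < c \<Longrightarrow> 0 < q' x"
    and mono: "strict_mono_on {a<..<c} (\<lambda>x. p' x / q' x)"
  shows "strict_mono_on {a<..<c} (\<lambda>x. p x / q x)"
proof (rule strict_mono_onI)
  have contq: "continuous_on {a..x} q" if "x < c" for x
    using that by (intro DERIV_continuous_on[where D = q'] has_field_derivative_at_within[OF q]) auto
  have q_pos: "0 < q x" if "a < x" "x < c" for x
  proof -
    have "q a < q x"
    proof (rule DERIV_pos_imp_increasing_open[OF that(1)])
      show "\<exists>d. (q has_real_derivative d) (at y) \<and> 0 < d" if "a < y" "y < x" for y
        using q[of y] q'_pos[of y] that \<open>x < c\<close> by force
    qed (use contq that in auto)
    then show ?thesis by (simp add: zero)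
  qed
  have der_pos: "0 < p' x * q x - p x * q' x" if x: "a < x" "x < c" for x
  proof -
    obtain z where z: "a < z" "z < x" and eq: "(p x - p a) * q' z = (q x - q a) * p' z"
    proof -
      have "\<exists>z>a. z < x \<and> (p x - p a) * q' z = (q x - q a) * p' z"
      proof (rule GMVT'[OF x(1)])
        show "isCont p z" if "a \<le> z" "z \<le> x" for z
          using that x by (intro DERIV_isCont[OF p]) auto
        show "isCont q z" if "a \<le> z" "z \<le> x" for z
          using that x by (intro DERIV_isCont[OF q]) auto
      qed (use p q x in auto)
      then show ?thesis using that by blast
    qed
    have "p' z / q' z < p' x / q' x"
      using strict_mono_onD[OF mono, of z x] z x by auto
    moreover have "p x / q x = p' z / q' z"
      using eq q_pos[OF x] q'_pos[of z] z x by (simp add: zero field_simps)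
    ultimately have "p x / q x < p' x / q' x" by simp
    then show ?thesis
      using q_pos[OF x] q'_pos[OF x] by (simp add: field_simps)
  qed
  fix x y assume xy: "x \<in> {a<..<c}" "y \<in> {a<..<c}" "x < y"
  show "p x / q x < p y / q y"
  proof (rule DERIV_pos_imp_increasing[OF xy(3)])
    fix z assume z: "x \<le> z" "z \<le> y"
    then have "((\<lambda>x. p x / q x) has_real_derivative (p' z * q z - p z * q' z) / (q z * q z)) (at z)"
      using q_pos[of z] xy by (intro DERIV_divide p q) auto
    moreover have "0 < (p' z * q z - p z * q' z) / (q z * q z)"
      using der_pos[of z] q_pos[of z] z xy by auto
    ultimately show "\<exists>d. ((\<lambda>x. p x / q x) has_real_derivative d) (at z) \<and> 0 < d" by blast
  qed
qed

lemma antimono_quotient: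
  fixes p q p' q' :: "real \<Rightarrow> real"
  assumes p: "\<And>x. a \<le> x \<Longrightarrow> x < c \<Longrightarrow> (p has_real_derivative p' x) (at x)"
    and q: "\<And>x. a \<le> x \<Longrightarrow> x < c \<Longrightarrow> (q has_real_derivative q' x) (at x)"
    and zero: "p a = 0" "q a = 0"
    and q'_pos: "\<And>x. a < x \<Longrightarrow> x < c \<Longrightarrow> 0 < q' x"
    and anti: "strict_antimono_on {a<..<c} (\<lambda>x. p' x / q' x)"
  shows "strict_antimono_on {a<..<c} (\<lambda>x. p x / q x)"
proof -
  have "strict_mono_on {a<..<c} (\<lambda>x. (- p' x) / q' x)"
    using anti by (auto simp: monotone_on_def)
  then have "strict_mono_on {a<..<c} (\<lambda>x. (- p x) / q x)"
    by (rule monotone_quotient[OF DERIV_minus[OF p] q, rotated -1]) (use zero q'_pos in simp_all)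
  then show ?thesis by (auto simp: monotone_on_def)
qed

section \<open>Decreasing trigonometric quotients in the half angle\<close>

lemma sin_minus_mult_cos_pos:
  fixes u :: real
  assumes "0 < u" "u < pi"
  shows "0 < sin u - u * cos u"
proof -
  have "sin 0 - 0 * cos 0 < sin u - u * cos u"
  proof (rule DERIV_pos_imp_increasing_open[OF assms(1)])
    fix v assume v: "0 < v" "v < u"
    have "((\<lambda>u. sin u - u * cos u) has_real_derivative v * sin v) (at v)"
      by (auto intro!: derivative_eq_intros)
    moreover have "0 < v * sin v"
      using v assms by (simp add: sin_gt_zero)
    ultimately show "\<exists>y. ((\<lambda>u. sin u - u * cos u) has_real_derivative y) (at v) \<and> y > 0"
      by blast
  qed (auto intro!: continuous_intros)
  then show ?thesis by simp
qed

text \<open>The numerator of the derivative is \<open>sin w * cos w - w\<close>, and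
  \<open>sin w * cos w < sin w <= w\<close>.\<close>

lemma mult_cot_antimono: "strict_antimono_on {0<..<pi} (\<lambda>u::real. u * cos u / sin u)"
proof (rule monotone_onI)
  fix u v :: real assume uv: "u \<in> {0<..<pi}" "v \<in> {0<..<pi}" "u < v"
  show "v * cos v / sin v < u * cos u / sin u"
  proof (rule DERIV_neg_imp_decreasing[OF uv(3)])
    fix w assume "u \<le> w" "w \<le> v"
    then have w: "0 < w" "w < pi" using uv by auto
    then have s: "0 < sin w" by (rule sin_gt_zero)
    have "((\<lambda>u. u * cos u / sin u) has_real_derivative
        ((cos w - w * sin w) * sin w - w * cos w * cos w) / (sin w * sin w)) (at w)"
      using s by (auto intro!: derivative_eq_intros)
    moreover have "(cos w - w * sin w) * sin w - w * cos w * cos w = sin w * cos w - w"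
      using sin_cos_squared_add[of w] by algebra
    moreover have "sin w * cos w < w"
    proof -
      have "cos w < cos 0" using w by (intro cos_monotone_0_pi) auto
      then have "sin w * cos w < sin w * 1" using s by (intro mult_strict_left_mono) auto
      moreover have "sin w \<le> w" using w by (intro sin_x_le_x) auto
      ultimately show ?thesis by simp
    qed
    ultimately show "\<exists>y. ((\<lambda>u. u * cos u / sin u) has_real_derivative y) (at w) \<and> y < 0"
      using s by (intro exI conjI) (assumption, simp add: divide_neg_pos)
  qed
qed

text \<open>Differentiating numerator and denominator leaves \<open>2 + u * cos u / sin u\<close>,
  which decreases by the previous lemma.\<close>

lemma sin_quotient_antimono:
  "strict_antimono_on {0<..<pi} (\<lambda>u::real. u\<^sup>2 * sin u / (sin u - u * cos u))"
proof (rule antimono_quotient[where p' = "\<lambda>u. 2 * u * sin u + u\<^sup>2 * cos u" and q' = "\<lambda>u. u * sin u"])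
  show "strict_antimono_on {0<..<pi} (\<lambda>u::real. (2 * u * sin u + u\<^sup>2 * cos u) / (u * sin u))"
  proof (rule monotone_onI)
    fix u v :: real assume uv: "u \<in> {0<..<pi}" "v \<in> {0<..<pi}" "u < v"
    have eq: "(2 * u * sin u + u\<^sup>2 * cos u) / (u * sin u) = 2 + u * cos u / sin u"
      if "u \<in> {0<..<pi}" for u :: real
      using that sin_gt_zero[of u] by (simp add: field_simps power2_eq_square)
    show "(2 * v * sin v + v\<^sup>2 * cos v) / (v * sin v) < (2 * u * sin u + u\<^sup>2 * cos u) / (u * sin u)"
      using monotone_onD[OF mult_cot_antimono uv] uv by (simp add: eq)
  qed
qed (auto intro!: derivative_eq_intros simp: sin_gt_zero power2_eq_square)

section \<open>The function \<open>D\<close>, here \<open>dfun\<close>, and the growth of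
  \<open>h\<close>, here \<open>crit_lam\<close>\<close>

definition dfun :: "real \<Rightarrow> real" where "dfun x = 2 * x + x * cos x - 3 * sin x"
definition dfun' :: "real \<Rightarrow> real" where "dfun' x = 2 - 2 * cos x - x * sin x"
definition dfun'' :: "real \<Rightarrow> real" where "dfun'' x = sin x - x * cos x"

lemma dfun_deriv [derivative_intros]: "(dfun has_real_derivative dfun' x) (at x)"
  unfolding dfun_def dfun'_def by (auto intro!: derivative_eq_intros)

lemma dfun'_deriv: "(dfun' has_real_derivative dfun'' x) (at x)"
  unfolding dfun'_def dfun''_def by (auto intro!: derivative_eq_intros)

text \<open>This factorisation makes the sign visible: for \<open>x / 2\<close> in
  \<open>(0, pi)\<close> both factors are positive.\<close>

lemma dfun'_half_angle:
  "dfun' x = 4 * sin (x / 2) * (sin (x / 2) - x / 2 * cos (x / 2))"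
proof -
  have "dfun' (2 * u) = 4 * sin u * (sin u - u * cos u)" for u
    unfolding dfun'_def sin_double cos_double_sin by algebra
  from this[of "x / 2"] show ?thesis by simp
qed

lemma dfun'_pos:
  assumes "0 < x" "x < 2 * pi"
  shows "0 < dfun' x"
  using assms sin_gt_zero[of "x / 2"] sin_minus_mult_cos_pos[of "x / 2"]
  by (simp add: dfun'_half_angle)

text \<open>The half angle splits the quotient into exactly the two quotients already known to
  decrease.\<close>

lemma dfun''_half_angle:
  assumes "0 < x" "x < 2 * pi"
  shows "x * dfun'' x / dfun' x = x / 2 * cos (x / 2) / sin (x / 2)
    + (x / 2)\<^sup>2 * sin (x / 2) / (sin (x / 2) - x / 2 * cos (x / 2))"
proof -
  define u where "u = x / 2"
  have u: "0 < u" "u < pi" "x = 2 * u" using assms by (auto simp: u_def)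
  let ?s = "sin u" and ?c = "cos u" and ?e = "sin u - u * cos u"
  have pos: "0 < ?s" "0 < ?e" using u sin_gt_zero[of u] sin_minus_mult_cos_pos[of u] by simp_all
  have cs: "?c\<^sup>2 = 1 - ?s\<^sup>2" by (rule cos_squared_eq)
  have d: "dfun' (2 * u) = 4 * (?s * ?e)" by (simp only: dfun'_half_angle) simp
  have n: "2 * u * dfun'' (2 * u) = 4 * (u * ?c * ?e + u\<^sup>2 * ?s\<^sup>2)"
    unfolding dfun''_def sin_double cos_double using cs by algebra
  have "2 * u * dfun'' (2 * u) / dfun' (2 * u) = (u * ?c * ?e + u\<^sup>2 * ?s\<^sup>2) / (?s * ?e)"
    unfolding d n by (rule mult_divide_mult_cancel_left) simp
  also have "\<dots> = u * ?c / ?s + u\<^sup>2 * ?s / ?e"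
  proof -
    have "(u * c * e + u\<^sup>2 * s\<^sup>2) / (s * e) = u * c / s + u\<^sup>2 * s / e"
      if "s \<noteq> 0" "e \<noteq> 0" for s c e :: real
      using that by (simp add: add_divide_distrib power2_eq_square)
    from this[of ?s ?e] pos show ?thesis by fastforce
  qed
  finally show ?thesis unfolding u(3) by simp
qed

lemma dfun''_quotient_antimono: "strict_antimono_on {0<..<2 * pi} (\<lambda>x. x * dfun'' x / dfun' x)"
proof (rule monotone_onI)
  fix x y assume xy: "x \<in> {0<..<2 * pi}" "y \<in> {0<..<2 * pi}" "x < y"
  show "y * dfun'' y / dfun' y < x * dfun'' x / dfun' x"
    using monotone_onD[OF mult_cot_antimono, of "x / 2" "y / 2"]
      monotone_onD[OF sin_quotient_antimono, of "x / 2" "y / 2"] xy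
    by (simp add: dfun''_half_angle)
qed

lemma dfun_pos:
  assumes "0 < x"
  shows "0 < dfun x"
proof (cases "x < 2 * pi")
  case True
  have "dfun 0 < dfun x"
  proof (rule DERIV_pos_imp_increasing_open[OF assms])
    show "\<exists>d. (dfun has_real_derivative d) (at y) \<and> 0 < d" if "0 < y" "y < x" for y
      using that True dfun_deriv dfun'_pos[of y] by (intro exI[of _ "dfun' y"]) auto
    show "continuous_on {0..x} dfun" 
      by (rule DERIV_continuous_on[where D = dfun']) (rule has_field_derivative_at_within[OF dfun_deriv])
  qed
  then show ?thesis by (simp add: dfun_def)
next
  case False
  \<comment> \<open>Beyond \<open>2 pi\<close> a crude estimate is enough:
    \<open>2 * x + x * cos x >= x > 3 >= 3 * sin x\<close>.\<close>
  then have "x > 3" using pi_gt3 by simp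
  moreover have "x * (- 1) \<le> x * cos x" using assms by (intro mult_left_mono) auto
  ultimately show ?thesis using sin_le_one[of x] unfolding dfun_def by linarith
qed

text \<open>The quotient of the derivatives is \<open>1 + x * dfun'' x / dfun' x\<close>.\<close>

lemma dfun'_quotient_antimono: "strict_antimono_on {0<..<2 * pi} (\<lambda>x. x * dfun' x / dfun x)"
proof (rule antimono_quotient[where p' = "\<lambda>x. dfun' x + x * dfun'' x" and q' = dfun'])
  show "strict_antimono_on {0<..<2 * pi} (\<lambda>x. (dfun' x + x * dfun'' x) / dfun' x)"
  proof (rule monotone_onI)
    fix x y assume xy: "x \<in> {0<..<2 * pi}" "y \<in> {0<..<2 * pi}" "x < y"
    show "(dfun' y + y * dfun'' y) / dfun' y < (dfun' x + x * dfun'' x) / dfun' x"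
      using monotone_onD[OF dfun''_quotient_antimono xy] dfun'_pos[of x] dfun'_pos[of y] xy
      by (simp add: add_divide_distrib)
  qed
qed (auto intro!: derivative_eq_intros dfun_deriv dfun'_deriv dfun'_pos, simp add: dfun_def)

text \<open>Since \<open>theta3_lhs lam x\<close> is affine in \<open>lam\<close>, each
  \<open>x > 0\<close> is a critical point of the radicand for exactly one parameter, and this is
  its value.\<close>

definition crit_lam :: "real \<Rightarrow> real" where
  "crit_lam x = - theta3_lhs 0 x / (2 * x ^ 3 * dfun x)"

lemma theta3_lhs_eq:
  assumes "0 < x"
  shows "theta3_lhs lam x = 2 * x ^ 3 * dfun x * (lam - crit_lam x)"
proof -
  have "theta3_lhs lam x = 2 * x ^ 3 * dfun x * lam + theta3_lhs 0 x"
    unfolding theta3_lhs_def dfun_def by algebra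
  then show ?thesis
    using assms dfun_pos[OF assms] by (simp add: crit_lam_def distrib_left)
qed

text \<open>The quotient of the derivatives is \<open>3 / (3 + x * dfun' x / dfun x)\<close>, which
  increases because \<open>x * dfun' x / dfun x\<close> is positive and decreasing.\<close>

lemma crit_lam_mono: "strict_mono_on {0<..<2 * pi} crit_lam"
proof -
  have "strict_mono_on {0<..<2 * pi} (\<lambda>x. - theta3_lhs 0 x / (2 * x ^ 3 * dfun x))"
  proof (rule monotone_quotient[where p' = "\<lambda>x. 6 * x\<^sup>2 * dfun x"
        and q' = "\<lambda>x. 2 * x\<^sup>2 * (3 * dfun x + x * dfun' x)"])
    show "((\<lambda>x. - theta3_lhs 0 x) has_real_derivative 6 * x\<^sup>2 * dfun x) (at x)" for x
      unfolding theta3_lhs_def dfun_def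
      by (auto intro!: derivative_eq_intros
          simp: algebra_simps power2_eq_square power3_eq_cube power4_eq_xxxx)
    show "((\<lambda>x. 2 * x ^ 3 * dfun x) has_real_derivative 2 * x\<^sup>2 * (3 * dfun x + x * dfun' x)) (at x)" for x
      by (auto intro!: derivative_eq_intros dfun_deriv
          simp: algebra_simps power2_eq_square power3_eq_cube)
    show "strict_mono_on {0<..<2 * pi}
      (\<lambda>x. 6 * x\<^sup>2 * dfun x / (2 * x\<^sup>2 * (3 * dfun x + x * dfun' x)))"
    proof (rule monotone_onI)
      fix x y assume xy: "x \<in> {0<..<2 * pi}" "y \<in> {0<..<2 * pi}" "x < y"
      have eq: "6 * x\<^sup>2 * dfun x / (2 * x\<^sup>2 * (3 * dfun x + x * dfun' x)) = 3 / (3 + x * dfun' x / dfun x)"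
        if "x \<in> {0<..<2 * pi}" for x
      proof -
        have d: "0 < x" "0 < dfun x" "0 < dfun' x" using that dfun_pos dfun'_pos by auto
        have "6 * x\<^sup>2 * dfun x / (2 * x\<^sup>2 * (3 * dfun x + x * dfun' x))
            = (2 * x\<^sup>2) * (3 * dfun x) / (2 * x\<^sup>2 * (3 * dfun x + x * dfun' x))" by simp
        also have "\<dots> = (3 * dfun x) / (3 * dfun x + x * dfun' x)"
          using d by (intro mult_divide_mult_cancel_left) simp
        also have "\<dots> = 3 / (3 + x * dfun' x / dfun x)"
          using d by (simp add: divide_simps add_pos_pos)
        finally show ?thesis .
      qed
      have pos: "0 < x * dfun' x / dfun x" if "x \<in> {0<..<2 * pi}" for x
        using that dfun_pos[of x] dfun'_pos[of x] by simp
      show "6 * x\<^sup>2 * dfun x / (2 * x\<^sup>2 * (3 * dfun x + x * dfun' x))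
        < 6 * y\<^sup>2 * dfun y / (2 * y\<^sup>2 * (3 * dfun y + y * dfun' y))"
        unfolding eq[OF xy(1)] eq[OF xy(2)]
        using monotone_onD[OF dfun'_quotient_antimono xy] pos[OF xy(1)] pos[OF xy(2)]
        by (intro divide_strict_left_mono mult_pos_pos) auto
    qed
  qed (auto simp: theta3_lhs_def intro!: add_pos_pos dfun_pos dfun'_pos mult_pos_pos)
  then show ?thesis by (simp add: crit_lam_def[abs_def])
qed


text \<open>Near 0 the numerator behaves like \<open>x ^ 8 / 80\<close> and \<open>dfun x\<close>
  like \<open>x ^ 5 / 60\<close>. This is the origin of the threshold \<open>3 / 8\<close>.\<close>

lemma crit_lam_tendsto: "(crit_lam \<longlongrightarrow> 3 / 8) (at_right 0)"
proof -
  have "((\<lambda>x. - theta3_lhs 0 x / x ^ 8) \<longlongrightarrow> 1 / 80) (at_right 0)"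
    unfolding theta3_lhs_def by real_asymp
  moreover have "((\<lambda>x. 2 * (dfun x / x ^ 5)) \<longlongrightarrow> 2 * (1 / 60)) (at_right 0)"
    unfolding dfun_def by (intro tendsto_mult_left) real_asymp
  ultimately have "((\<lambda>x. (- theta3_lhs 0 x / x ^ 8) / (2 * (dfun x / x ^ 5))) \<longlongrightarrow> (1 / 80) / (2 * (1 / 60)))
      (at_right 0)"
    by (rule tendsto_divide) simp
  moreover have "\<forall>\<^sub>F x in at_right 0. (- theta3_lhs 0 x / x ^ 8) / (2 * (dfun x / x ^ 5)) = crit_lam x"
    using eventually_at_right_less[of 0]
  proof eventually_elim
    case (elim x)
    then show ?case
      using dfun_pos[of x] by (simp add: crit_lam_def field_simps flip: power_add)
  qed
  ultimately show ?thesis by (simp add: tendsto_cong)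
qed

subsection \<open>The radicand\<close>

definition re_quot :: "real \<Rightarrow> real" where "re_quot x = 6 * (cos x - 1 + x\<^sup>2 / 2) / x ^ 3"
definition im_quot :: "real \<Rightarrow> real" where "im_quot x = 6 * (x - sin x) / x ^ 3"
text \<open>Geometrically, the squared distance from the point \<open>(re_quot x, im_quot x)\<close>
  to \<open>(0, lam)\<close>; the parameter moves the second point along an axis.\<close>

definition dev :: "real \<Rightarrow> real \<Rightarrow> real" where
  "dev lam x = (re_quot x)\<^sup>2 + (im_quot x - lam)\<^sup>2"

text \<open>The two summands are, up to a common positive factor, the contributions of
  \<open>re_quot\<close> and of \<open>im_quot\<close> to the derivative of \<open>dev lam\<close>.
  The first contains the left-hand side of the equation that defines
  \<open>theta3_star\<close>.\<close>

lemma theta3_lhs_split: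
  "theta3_lhs lam x = - 6 * (cos x - 1 + x\<^sup>2 / 2) * (x\<^sup>2 + 2 * x * sin x + 6 * (cos x - 1))
     - 12 * (x - sin x - lam * x ^ 3 / 6) * dfun x"
proof -
  have s: "(sin x)\<^sup>2 + (cos x)\<^sup>2 = 1" by simp
  define h where "h = x\<^sup>2 / 2"
  define k where "k = lam * x ^ 3 / 6"
  have hk: "x\<^sup>2 = 2 * h" "lam * x ^ 3 = 6 * k" by (simp_all add: h_def k_def)
  show ?thesis
    unfolding theta3_lhs_def dfun_def h_def[symmetric] k_def[symmetric] using s hk by algebra
qed

lemma re_quot_deriv:
  assumes "0 < x"
  shows "(re_quot has_real_derivative - 3 * (x\<^sup>2 + 2 * x * sin x + 6 * (cos x - 1)) / x ^ 4) (at x)"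
proof -
  have "(re_quot has_real_derivative
      (6 * (x - sin x) * x ^ 3 - 6 * (cos x - 1 + x\<^sup>2 / 2) * (3 * x\<^sup>2)) / (x ^ 3 * x ^ 3)) (at x)"
    unfolding re_quot_def using assms by (auto intro!: derivative_eq_intros)
  moreover have "(6 * (x - sin x) * x ^ 3 - 6 * (cos x - 1 + x\<^sup>2 / 2) * (3 * x\<^sup>2)) / (x ^ 3 * x ^ 3)
      = - 3 * (x\<^sup>2 + 2 * x * sin x + 6 * (cos x - 1)) / x ^ 4"
    using assms by (simp add: divide_simps) (simp add: algebra_simps power_numeral_reduce)
  ultimately show ?thesis by simp
qed

lemma im_quot_deriv:
  assumes "0 < x"
  shows "(im_quot has_real_derivative - 6 * dfun x / x ^ 4) (at x)"
proof -
  have "(im_quot has_real_derivative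
      (6 * (1 - cos x) * x ^ 3 - 6 * (x - sin x) * (3 * x\<^sup>2)) / (x ^ 3 * x ^ 3)) (at x)"
    unfolding im_quot_def using assms by (auto intro!: derivative_eq_intros)
  moreover have "(6 * (1 - cos x) * x ^ 3 - 6 * (x - sin x) * (3 * x\<^sup>2)) / (x ^ 3 * x ^ 3)
      = - 6 * dfun x / x ^ 4"
    unfolding dfun_def
    using assms by (simp add: divide_simps) (simp add: algebra_simps power_numeral_reduce)
  ultimately show ?thesis by simp
qed

lemma im_quot_antimono:
  assumes "0 < x" "x < y"
  shows "im_quot y < im_quot x"
proof (rule DERIV_neg_imp_decreasing[OF assms(2)])
  fix z assume "x \<le> z" "z \<le> y"
  then have z: "0 < z" using assms by simp
  then show "\<exists>d. (im_quot has_real_derivative d) (at z) \<and> d < 0"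
    using im_quot_deriv[OF z] dfun_pos[OF z] by (intro exI conjI) (assumption, simp)
qed

lemma im_quot_antimono_le: "0 < x \<Longrightarrow> x \<le> y \<Longrightarrow> im_quot y \<le> im_quot x"
  using im_quot_antimono[of x y] by (cases "x = y") auto

lemma dev_deriv:
  assumes "0 < x"
  shows "(dev lam has_real_derivative 6 * theta3_lhs lam x / x ^ 7) (at x)"
proof -
  have "(dev lam has_real_derivative
      2 * re_quot x * (- 3 * (x\<^sup>2 + 2 * x * sin x + 6 * (cos x - 1)) / x ^ 4)
      + 2 * (im_quot x - lam) * (- 6 * dfun x / x ^ 4)) (at x)"
  proof -
    have "(dev lam has_real_derivative 2 * re_quot x * r + 2 * (im_quot x - lam) * i) (at x)"
      if "(re_quot has_real_derivative r) (at x)" "(im_quot has_real_derivative i) (at x)" for r i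
      unfolding dev_def using that by (auto intro!: derivative_eq_intros)
    then show ?thesis using re_quot_deriv[OF assms] im_quot_deriv[OF assms] .
  qed
  moreover have "2 * (6 * A / x ^ 3) * (- 3 * g / x ^ 4) + 2 * (6 * B / x ^ 3 - lam) * (- 6 * D / x ^ 4)
      = 6 * (- 6 * A * g - 12 * (B - lam * x ^ 3 / 6) * D) / x ^ 7" for A g B D
    using assms by (simp add: field_simps power_numeral_reduce)
  ultimately show ?thesis
    by (simp only: re_quot_def im_quot_def theta3_lhs_split)
qed

lemma dev_tendsto: "(dev lam \<longlongrightarrow> (1 - lam)\<^sup>2) (at_right 0)"
proof -
  have "(re_quot \<longlongrightarrow> 0) (at_right 0)" unfolding re_quot_def by real_asymp
  moreover have "(im_quot \<longlongrightarrow> 1) (at_right 0)" unfolding im_quot_def by real_asymp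
  ultimately have "(dev lam \<longlongrightarrow> 0\<^sup>2 + (1 - lam)\<^sup>2) (at_right 0)"
    unfolding dev_def by (intro tendsto_intros)
  then show ?thesis by simp
qed

lemma sqrt_dev:
  assumes "0 < x"
  shows "6 / x ^ 3 * sqrt ((cos x - 1 + x ^ 2 / 2) ^ 2 + (sin x - x + lam * x ^ 3 / 6) ^ 2)
    = sqrt (dev lam x)"
proof -
  have "dev lam x = (6 / x ^ 3)\<^sup>2 * ((cos x - 1 + x\<^sup>2 / 2)\<^sup>2 + (sin x - x + lam * x ^ 3 / 6)\<^sup>2)"
  proof -
    have "re_quot x = 6 / x ^ 3 * (cos x - 1 + x\<^sup>2 / 2)" by (simp add: re_quot_def)
    moreover have "im_quot x - lam = - (6 / x ^ 3 * (sin x - x + lam * x ^ 3 / 6))"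
      using assms by (simp add: im_quot_def field_simps)
    ultimately show ?thesis by (simp only: dev_def power2_minus power_mult_distrib) (simp only: distrib_left)
  qed
  then show ?thesis using assms by (simp add: real_sqrt_mult)
qed

lemma norm_eq_sqrt_dev:
  assumes "0 < x"
  shows "fact 3 / x ^ 3 *
     cmod (exp (\<i> * of_real x) - (\<Sum>k=0..2. (\<i> * of_real x) ^ k / fact k)
           - of_real lam * ((\<i> * of_real x) ^ 3 / fact 3)) = sqrt (dev lam x)"
proof -
  let ?z = "exp (\<i> * of_real x) - (\<Sum>k=0..2. (\<i> * of_real x) ^ k / fact k)
           - of_real lam * ((\<i> * of_real x) ^ 3 / fact 3)"
  have "?z = Complex (cos x - 1 + x\<^sup>2 / 2) (sin x - x + lam * x ^ 3 / 6)"
    by (simp add: complex_eq_iff Re_exp Im_exp eval_nat_numeral)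
  then have "cmod ?z = sqrt ((cos x - 1 + x\<^sup>2 / 2)\<^sup>2 + (sin x - x + lam * x ^ 3 / 6)\<^sup>2)"
    by (simp only: complex_norm)
  moreover have fact_3: "fact 3 = (6::real)" by (simp add: fact_numeral)
  ultimately show ?thesis
    using sqrt_dev[OF assms, of lam] by (simp only: fact_3)
qed

lemma q3_eq_SUP: "q3 lam = (SUP x\<in>{0<..}. sqrt (dev lam x))"
  unfolding q3_def by (intro SUP_cong refl norm_eq_sqrt_dev) simp

lemma sqrt_dev_le_q3:
  assumes "0 < x"
  shows "sqrt (dev lam x) \<le> q3 lam"
  unfolding norm_eq_sqrt_dev[OF assms, symmetric] q3_def
  by (rule cSUP_upper[OF _ bdd_above_q3]) (use assms in simp)

lemma q3_le:
  assumes "\<And>x. 0 < x \<Longrightarrow> dev lam x \<le> c\<^sup>2" "0 \<le> c"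
  shows "q3 lam \<le> c"
  unfolding q3_eq_SUP using assms by (intro cSUP_least) (auto intro: real_le_lsqrt)

text \<open>The bound 0.35 lies below both \<open>(5 / 8) ^ 2\<close> and
  \<open>0.594971 ^ 2\<close>, so the range \<open>x >= 2 pi\<close> cannot raise the supremum. The
  number 0.4467 is an upper bound for \<open>lam_star\<close>.\<close>

lemma dev_le_tail:
  assumes x: "6 \<le> x" and lam: "0 \<le> lam" "lam \<le> 0.4467"
  shows "dev lam x \<le> 0.35"
proof -
  define u where "u = 1 / x\<^sup>2"
  have x2: "36 \<le> x\<^sup>2" using power_mono[OF x, of 2] by simp
  have u: "0 < u" "u \<le> 1 / 36" using x x2 by (auto simp: u_def field_simps)
  have "0 \<le> cos x - 1 + x\<^sup>2 / 2"
    using x2 cos_ge_minus_one[of x] by linarith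
  then have "0 \<le> re_quot x"
    unfolding re_quot_def using x by (intro divide_nonneg_nonneg mult_nonneg_nonneg) auto
  moreover have "re_quot x \<le> 3 / x"
  proof -
    have "re_quot x \<le> 6 * (x\<^sup>2 / 2) / x ^ 3"
      unfolding re_quot_def using x by (intro divide_right_mono mult_left_mono) auto
    then show ?thesis using x by (simp add: power2_eq_square power3_eq_cube)
  qed
  ultimately have "(re_quot x)\<^sup>2 \<le> (3 / x)\<^sup>2" by (intro power_mono)
  then have re: "(re_quot x)\<^sup>2 \<le> 9 * u" by (simp add: u_def power_divide)
  have "6 * (5 / 6 * x) / x ^ 3 \<le> im_quot x" "im_quot x \<le> 6 * (7 / 6 * x) / x ^ 3"
  proof -
    \<comment> \<open>Here \<open>\<bar>sin x\<bar> \<le> 1 \<le> x / 6\<close>.\<close>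
    have "5 / 6 * x \<le> x - sin x" "x - sin x \<le> 7 / 6 * x"
      using x sin_le_one[of x] sin_ge_minus_one[of x] by linarith+
    then show "6 * (5 / 6 * x) / x ^ 3 \<le> im_quot x" "im_quot x \<le> 6 * (7 / 6 * x) / x ^ 3"
      unfolding im_quot_def using x by (intro divide_right_mono mult_left_mono; simp)+
  qed
  then have im: "5 * u \<le> im_quot x" "im_quot x \<le> 7 * u"
    using x by (simp_all add: u_def power2_eq_square power3_eq_cube)
  show ?thesis
  proof (cases "im_quot x \<le> lam")
    case True
    then have "(lam - im_quot x)\<^sup>2 \<le> (0.4467 - 5 * u)\<^sup>2"
      using im lam by (intro power_mono) auto
    then have "dev lam x \<le> 9 * u + (0.4467 - 5 * u)\<^sup>2"
      using re by (simp add: dev_def power2_commute)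
    \<comment> \<open>In this form the bound visibly increases with \<open>u\<close>, so its largest
      value is at \<open>u = 1 / 36\<close>.\<close>
    also have "\<dots> = 0.4467\<^sup>2 + u * (25 * u + 4.533)" by (simp add: power2_eq_square algebra_simps)
    also have "\<dots> \<le> 0.4467\<^sup>2 + 1 / 36 * (25 * (1 / 36) + 4.533)"
      using u by (intro add_left_mono mult_mono) auto
    also have "\<dots> \<le> 0.35" by (simp add: power2_eq_square)
    finally show ?thesis .
  next
    case False
    then have "(im_quot x - lam)\<^sup>2 \<le> (7 / 36)\<^sup>2"
      using im lam u by (intro power_mono) auto
    then show ?thesis using re u by (simp add: dev_def power2_eq_square)
  qed
qed

section \<open>Critical points and monotonicity of the radicand on \<open>(0, 2 pi)\<close>\<close>

lemma crit_lam_gt: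
  assumes "0 < x" "x < 2 * pi"
  shows "3 / 8 < crit_lam x"
proof -
  \<comment> \<open>The limit at 0 yields only a weak inequality; going through the intermediate
    point \<open>x / 2\<close> restores strictness.\<close>
  have "3 / 8 \<le> crit_lam (x / 2)"
  proof (rule tendsto_upperbound[OF crit_lam_tendsto])
    show "\<forall>\<^sub>F y in at_right 0. crit_lam y \<le> crit_lam (x / 2)"
      unfolding eventually_at_right_field
      using assms strict_mono_onD[OF crit_lam_mono, of _ "x / 2"]
      by (intro exI[of _ "x / 2"]) (auto intro: less_imp_le)
  qed simp
  also have "crit_lam (x / 2) < crit_lam x"
    using assms by (intro strict_mono_onD[OF crit_lam_mono]) auto
  finally show ?thesis .
qed

lemma crit_lam_surj:
  assumes lam: "3 / 8 < lam" "lam \<le> crit_lam t" and t: "0 < t" "t < 2 * pi"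
  obtains x where "0 < x" "x \<le> t" "crit_lam x = lam"
proof -
  have "\<forall>\<^sub>F y in at_right 0. crit_lam y < lam"
    using order_tendstoD(2)[OF crit_lam_tendsto lam(1)] .
  moreover have "\<forall>\<^sub>F y in at_right (0::real). y \<in> {0<..<t}"
    using t by (intro eventually_at_right_real)
  ultimately have "\<forall>\<^sub>F y in at_right 0. crit_lam y < lam \<and> y \<in> {0<..<t}"
    by eventually_elim simp
  then obtain y where y: "crit_lam y < lam" "0 < y" "y < t"
    using eventually_happens trivial_limit_at_right_real by fastforce
  \<comment> \<open>The intermediate value theorem is applied to \<open>theta3_lhs lam\<close>,
    which has the sign of \<open>lam - crit_lam\<close> and is continuous everywhere.\<close>
  have "\<exists>x\<ge>y. x \<le> t \<and> theta3_lhs lam x = 0"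
  proof (rule IVT2')
    show "theta3_lhs lam t \<le> 0"
      using t lam dfun_pos[of t] by (simp add: theta3_lhs_eq mult_nonneg_nonpos)
    show "0 \<le> theta3_lhs lam y"
      using y dfun_pos[of y] by (simp add: theta3_lhs_eq)
    show "continuous_on {y..t} (theta3_lhs lam)"
      unfolding theta3_lhs_def by (intro continuous_intros)
  qed (use y in simp)
  then obtain x where x: "y \<le> x" "x \<le> t" "theta3_lhs lam x = 0" by blast
  then have "0 < x" using y by simp
  then have "crit_lam x = lam"
    using x(3) dfun_pos[of x] by (simp add: theta3_lhs_eq)
  with that \<open>0 < x\<close> x show thesis by blast
qed

lemma theta3_lhs_zero_iff:
  assumes "0 < x"
  shows "theta3_lhs lam x = 0 \<longleftrightarrow> crit_lam x = lam"
  using assms dfun_pos[of x] by (auto simp: theta3_lhs_eq)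

text \<open>The derivative of \<open>dev lam\<close> has the sign of \<open>lam - crit_lam\<close>.
  As \<open>crit_lam\<close> increases, a nonpositive sign persists to the right; in the next lemma
  a nonnegative one persists to the left.\<close>

lemma dev_le_of_le:
  assumes "lam \<le> crit_lam x" "0 < x" "x \<le> y" "y < 2 * pi"
  shows "dev lam y \<le> dev lam x"
proof (rule DERIV_nonpos_imp_nonincreasing[OF assms(3)])
  fix z assume z: "x \<le> z" "z \<le> y"
  then have "crit_lam x \<le> crit_lam z"
    using assms by (intro strict_mono_on_leD[OF crit_lam_mono]) auto
  then have "theta3_lhs lam z \<le> 0"
    using z assms dfun_pos[of z] by (simp add: theta3_lhs_eq mult_nonneg_nonpos)
  then show "\<exists>d. (dev lam has_real_derivative d) (at z) \<and> d \<le> 0"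
    using dev_deriv[of z lam] z assms by (intro exI conjI) (simp, simp add: divide_nonpos_pos)
qed

lemma dev_le_of_ge:
  assumes "crit_lam y \<le> lam" "0 < x" "x \<le> y" "y < 2 * pi"
  shows "dev lam x \<le> dev lam y"
proof (rule DERIV_nonneg_imp_nondecreasing[OF assms(3)])
  fix z assume z: "x \<le> z" "z \<le> y"
  then have "crit_lam z \<le> crit_lam y"
    using assms by (intro strict_mono_on_leD[OF crit_lam_mono]) auto
  then have "0 \<le> theta3_lhs lam z"
    using z assms dfun_pos[of z] by (simp add: theta3_lhs_eq)
  then show "\<exists>d. (dev lam has_real_derivative d) (at z) \<and> 0 \<le> d"
    using dev_deriv[of z lam] z assms by (intro exI conjI) (simp, simp)
qed

text \<open>For these parameters \<open>lam < crit_lam\<close> on the whole interval, so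
  \<open>dev lam\<close> is nonincreasing there and bounded by its limit at 0.\<close>

lemma dev_le_limit:
  assumes "lam \<le> 3 / 8" "0 < x" "x < 2 * pi"
  shows "dev lam x \<le> (1 - lam)\<^sup>2"
proof (rule tendsto_lowerbound[OF dev_tendsto])
  show "\<forall>\<^sub>F y in at_right 0. dev lam x \<le> dev lam y"
    unfolding eventually_at_right_field
  proof (intro exI[of _ x] conjI allI impI)
    fix y assume "0 < y" "y < x"
    then show "dev lam x \<le> dev lam y"
      using assms crit_lam_gt[of y] by (intro dev_le_of_le) auto
  qed (use assms in simp)
qed simp

lemma q3_ge_limit: "\<bar>1 - lam\<bar> \<le> q3 lam"
proof -
  have "((\<lambda>x. sqrt (dev lam x)) \<longlongrightarrow> sqrt ((1 - lam)\<^sup>2)) (at_right 0)"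
    by (intro tendsto_real_sqrt dev_tendsto)
  then have "sqrt ((1 - lam)\<^sup>2) \<le> q3 lam"
  proof (rule tendsto_upperbound)
    show "\<forall>\<^sub>F x in at_right 0. sqrt (dev lam x) \<le> q3 lam"
      using eventually_at_right_less[of 0] by eventually_elim (rule sqrt_dev_le_q3)
  qed simp
  then show ?thesis by simp
qed

lemma q3_small:
  assumes "0 \<le> lam" "lam \<le> 3 / 8"
  shows "q3 lam = 1 - lam"
proof (rule antisym)
  show "q3 lam \<le> 1 - lam"
  proof (rule q3_le)
    fix x :: real assume x: "0 < x"
    show "dev lam x \<le> (1 - lam)\<^sup>2"
    proof (cases "x < 2 * pi")
      case True
      then show ?thesis using assms x by (intro dev_le_limit)
    next
      case False
      then have "dev lam x \<le> 0.35" using assms pi_gt3 by (intro dev_le_tail) auto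
      also have "0.35 \<le> (1 - 3 / 8 :: real)\<^sup>2" by (simp add: power2_eq_square)
      also have "\<dots> \<le> (1 - lam)\<^sup>2" using assms by (intro power_mono) auto
      finally show ?thesis .
    qed
  qed (use assms in simp)
  show "1 - lam \<le> q3 lam" using q3_ge_limit[of lam] by simp
qed

subsection \<open>Numerical bounds\<close>

text \<open>Lagrange's form of the remainder, in which the cosine factor is at most 1 in absolute
  value.\<close>

lemma Maclaurin_cos_bound:
  "\<bar>cos x - (\<Sum>m<n. cos_coeff m * x ^ m)\<bar> \<le> inverse (fact n) * \<bar>x\<bar> ^ n"
proof -
  obtain t where "cos x = (\<Sum>m<n. cos_coeff m * x ^ m) + (cos (t + 1/2 * real n * pi) / fact n) * x ^ n"
    using Maclaurin_cos_expansion[of x n] by blast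
  then have "cos x - (\<Sum>m<n. cos_coeff m * x ^ m) = cos (t + 1/2 * real n * pi) * (inverse (fact n) * x ^ n)"
    by (simp only: divide_inverse mult.assoc add_diff_cancel_left')
  then have "\<bar>cos x - (\<Sum>m<n. cos_coeff m * x ^ m)\<bar>
      = \<bar>cos (t + 1/2 * real n * pi)\<bar> * (inverse (fact n) * \<bar>x\<bar> ^ n)"
    by (simp only: abs_mult power_abs abs_inverse abs_of_nonneg[OF fact_ge_zero])
  also have "\<dots> \<le> 1 * (inverse (fact n) * \<bar>x\<bar> ^ n)"
    by (intro mult_right_mono) auto
  finally show ?thesis by simp
qed

text \<open>With 25 coefficients the remainder \<open>4 ^ 25 / fact 25\<close> is below
  \<open>1 / 10 ^ 10\<close>, which leaves room for rounding the polynomial.\<close>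

lemma sin_4: "\<bar>sin 4 - (- 0.7568024953)\<bar> \<le> (1 / 10 ^ 9 :: real)"
  using Maclaurin_sin_bound[of 4 25] unfolding abs_le_iff
  by (simp add: sin_coeff_def lessThan_nat_numeral fact_numeral)

lemma cos_4: "\<bar>cos 4 - (- 0.6536436209)\<bar> \<le> (1 / 10 ^ 9 :: real)"
  using Maclaurin_cos_bound[of 4 25] unfolding abs_le_iff
  by (simp add: cos_coeff_def lessThan_nat_numeral fact_numeral)

lemma sin_small: "\<bar>sin e - (e - e ^ 3 / 6)\<bar> \<le> \<bar>e\<bar> ^ 5 / 120" for e :: real
  using Maclaurin_sin_bound[of e 5]
  by (simp add: sin_coeff_def lessThan_nat_numeral fact_numeral field_simps)

lemma cos_small: "\<bar>cos e - (1 - e ^ 2 / 2)\<bar> \<le> \<bar>e\<bar> ^ 4 / 24" for e :: real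
  using Maclaurin_cos_bound[of e 4]
  by (simp add: cos_coeff_def lessThan_nat_numeral fact_numeral field_simps)

text \<open>Propagates the numerical errors through the products in the addition theorems: for
  factors of size at most 1 the errors just add.\<close>

lemma mult_error:
  fixes a b :: real
  assumes "\<bar>a - A\<bar> \<le> u" "\<bar>b - B\<bar> \<le> v" "\<bar>A\<bar> \<le> 1" "\<bar>b\<bar> \<le> 1"
  shows "\<bar>a * b - A * B\<bar> \<le> u + v"
proof -
  have "a * b - A * B = (a - A) * b + A * (b - B)" by (simp add: algebra_simps)
  then have "\<bar>a * b - A * B\<bar> \<le> \<bar>a - A\<bar> * \<bar>b\<bar> + \<bar>A\<bar> * \<bar>b - B\<bar>"
    using abs_triangle_ineq[of "(a - A) * b" "A * (b - B)"] by (simp only: abs_mult)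
  also have "\<dots> \<le> u * 1 + 1 * v"
    using assms by (intro add_mono mult_mono) auto
  finally show ?thesis by simp
qed

text \<open>The two points enclose \<open>theta3_star\<close>; they are close to 4, so that their sines and cosines
  follow from the addition theorems and the Taylor series at 4 and near 0.\<close>

abbreviation theta_lower :: real where "theta_lower \<equiv> 3.9958956"
abbreviation theta_upper :: real where "theta_upper \<equiv> 3.9958958"

lemma sin_cos_theta_lower:
  "\<bar>sin theta_lower - (- 0.7541133134)\<bar> \<le> 1 / 10 ^ 8"
  "\<bar>cos theta_lower - (- 0.6567443266)\<bar> \<le> 1 / 10 ^ 8"
proof -
  let ?e = "0.0041044 :: real"
  have s: "\<bar>sin ?e - 0.0041043885\<bar> \<le> 1 / 10 ^ 9" and c: "\<bar>cos ?e - 0.999991577\<bar> \<le> 1 / 10 ^ 9"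
    using sin_small[of ?e] cos_small[of ?e] unfolding abs_le_iff by (simp_all add: power_divide)
  have eq: "theta_lower = 4 - ?e" unfolding abs_le_iff by simp
  show "\<bar>sin theta_lower - (- 0.7541133134)\<bar> \<le> 1 / 10 ^ 8"
    unfolding eq sin_diff using mult_error[OF sin_4 c] mult_error[OF cos_4 s] unfolding abs_le_iff by simp
  show "\<bar>cos theta_lower - (- 0.6567443266)\<bar> \<le> 1 / 10 ^ 8"
    unfolding eq cos_diff using mult_error[OF cos_4 c] mult_error[OF sin_4 s] unfolding abs_le_iff by simp
qed

lemma sin_cos_theta_upper:
  "\<bar>sin theta_upper - (- 0.7541134447)\<bar> \<le> 1 / 10 ^ 8"
  "\<bar>cos theta_upper - (- 0.6567441758)\<bar> \<le> 1 / 10 ^ 8"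
proof -
  let ?e = "0.0041042 :: real"
  have s: "\<bar>sin ?e - 0.0041041885\<bar> \<le> 1 / 10 ^ 9" and c: "\<bar>cos ?e - 0.9999915778\<bar> \<le> 1 / 10 ^ 9"
    using sin_small[of ?e] cos_small[of ?e] unfolding abs_le_iff by (simp_all add: power_divide)
  have eq: "theta_upper = 4 - ?e" unfolding abs_le_iff by simp
  show "\<bar>sin theta_upper - (- 0.7541134447)\<bar> \<le> 1 / 10 ^ 8"
    unfolding eq sin_diff using mult_error[OF sin_4 c] mult_error[OF cos_4 s] unfolding abs_le_iff by simp
  show "\<bar>cos theta_upper - (- 0.6567441758)\<bar> \<le> 1 / 10 ^ 8"
    unfolding eq cos_diff using mult_error[OF cos_4 c] mult_error[OF sin_4 s] unfolding abs_le_iff by simp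
qed

lemma theta3_star_root:
  "0 < theta3_star" "theta3_star < 2 * pi"
  "theta3_star\<^sup>2 + 2 * theta3_star * sin theta3_star + 6 * (cos theta3_star - 1) = 0"
  using theI'[OF theta3_star_ex1] by (auto simp: theta3_star_def)

text \<open>A sign change between the two points gives a root, and uniqueness in
  \<open>(0, 2 pi)\<close> identifies it with \<open>theta3_star\<close>.\<close>

lemma theta3_star_bounds: "theta_lower \<le> theta3_star" "theta3_star \<le> theta_upper"
proof -
  define g :: "real \<Rightarrow> real" where "g x = x\<^sup>2 + 2 * x * sin x + 6 * (cos x - 1)" for x
  have "g theta_lower \<le> 0"
    using sin_cos_theta_lower unfolding abs_le_iff by (simp add: g_def power2_eq_square)
  moreover have "0 \<le> g theta_upper"
    using sin_cos_theta_upper unfolding abs_le_iff by (simp add: g_def power2_eq_square)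
  ultimately have "\<exists>x\<ge>theta_lower. x \<le> theta_upper \<and> g x = 0"
    by (intro IVT') (auto simp: g_def intro!: continuous_intros)
  then obtain x where x: "theta_lower \<le> x" "x \<le> theta_upper" "g x = 0" by blast
  have "0 < x" "x < 2 * pi" using x pi_gt3 by simp_all
  then have "theta3_star = x"
    unfolding theta3_star_def using x(3) by (intro the1_equality theta3_star_ex1) (simp add: g_def)
  with x show "theta_lower \<le> theta3_star" "theta3_star \<le> theta_upper" by auto
qed

lemma lam_star_eq: "lam_star = im_quot theta3_star"
  by (simp add: lam_star_def im_quot_def)

lemma lam_star_bounds: "0.4466 \<le> lam_star" "lam_star < 0.4467"
proof -
  have "0.4466 \<le> im_quot theta_upper"
    using sin_cos_theta_upper(1) unfolding abs_le_iff by (simp add: im_quot_def power3_eq_cube)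
  also have "\<dots> \<le> lam_star"
    unfolding lam_star_eq by (intro im_quot_antimono_le theta3_star_root theta3_star_bounds)
  finally show "0.4466 \<le> lam_star" .
  have "lam_star \<le> im_quot theta_lower"
    unfolding lam_star_eq by (intro im_quot_antimono_le theta3_star_bounds) simp
  also have "\<dots> < 0.4467"
    using sin_cos_theta_lower(1) unfolding abs_le_iff by (simp add: im_quot_def power3_eq_cube)
  finally show "lam_star < 0.4467" .
qed

text \<open>Both terms of \<open>3 / x - 6 * (1 - cos x) / x ^ 3\<close> decrease before
  subtraction, so they are estimated at opposite ends of the enclosure, which is short enough to
  absorb the loss.\<close>

lemma re_quot_theta3_star_bounds:
  "0.594971 \<le> re_quot theta3_star" "re_quot theta3_star < 0.594972"
proof -
  have pi: "pi \<le> 3.2" using pi_approx by simp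
  have cos_mono: "cos x \<le> cos y" if "theta_lower \<le> x" "x \<le> y" "y \<le> theta_upper" for x y
  proof -
    \<comment> \<open>The enclosure lies beyond \<open>pi\<close>; reflection moves it into
      \<open>[0, pi]\<close>, where the cosine decreases.\<close>
    have "cos (2 * pi - x) \<le> cos (2 * pi - y)"
      using that pi pi_gt3 by (intro cos_monotone_0_pi_le) auto
    then show ?thesis by simp
  qed
  note b = theta3_star_bounds
  have eq: "re_quot theta3_star = 3 / theta3_star - 6 * (1 - cos theta3_star) / theta3_star ^ 3"
    using theta3_star_root(1) by (simp add: re_quot_def field_simps power2_eq_square power3_eq_cube)
  have "6 * (1 - cos theta3_star) / theta3_star ^ 3 \<le> 6 * (1 - cos theta_lower) / theta_lower ^ 3"
    using b cos_mono[of theta_lower theta3_star] by (intro frac_le power_mono) auto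
  moreover have "3 / theta_upper \<le> 3 / theta3_star" using b by (intro divide_left_mono) auto
  ultimately have "3 / theta_upper - 6 * (1 - cos theta_lower) / theta_lower ^ 3 \<le> re_quot theta3_star"
    unfolding eq by linarith
  moreover have "0.594971 \<le> 3 / theta_upper - 6 * (1 - cos theta_lower) / theta_lower ^ 3"
    using sin_cos_theta_lower(2) unfolding abs_le_iff
    by (simp add: diff_divide_distrib right_diff_distrib power3_eq_cube)
  ultimately show "0.594971 \<le> re_quot theta3_star" by linarith
  have "6 * (1 - cos theta_upper) / theta_upper ^ 3 \<le> 6 * (1 - cos theta3_star) / theta3_star ^ 3"
    using b cos_mono[of theta3_star theta_upper] by (intro frac_le power_mono) auto
  moreover have "3 / theta3_star \<le> 3 / theta_lower" using b by (intro divide_left_mono) auto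
  ultimately have "re_quot theta3_star \<le> 3 / theta_lower - 6 * (1 - cos theta_upper) / theta_upper ^ 3"
    unfolding eq by linarith
  moreover have "3 / theta_lower - 6 * (1 - cos theta_upper) / theta_upper ^ 3 < 0.594972"
    using sin_cos_theta_upper(2) unfolding abs_le_iff
    by (simp add: diff_divide_distrib right_diff_distrib power3_eq_cube)
  ultimately show "re_quot theta3_star < 0.594972" by linarith
qed

subsection \<open>The maximum and its dependence on the parameter\<close>

text \<open>Both summands of \<open>theta3_lhs_split\<close> vanish: the first by the equation for
  \<open>theta3_star\<close>, the second by the choice of \<open>lam_star\<close>.\<close>

lemma crit_lam_theta3_star: "crit_lam theta3_star = lam_star"
proof -
  have "theta3_star - sin theta3_star - lam_star * theta3_star ^ 3 / 6 = 0"
    using theta3_star_root(1) by (simp add: lam_star_def)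
  then have "theta3_lhs lam_star theta3_star = 0"
    by (simp only: theta3_lhs_split theta3_star_root(3))
  then show ?thesis using theta3_star_root(1) by (simp add: theta3_lhs_zero_iff)
qed

lemma ex1_theta3:
  assumes "3 / 8 < lam" "lam \<le> lam_star"
  shows "\<exists>!x. x \<in> {0<..<2 * pi} \<and> theta3_lhs lam x = 0"
proof -
  obtain x where x: "0 < x" "x \<le> theta3_star" "crit_lam x = lam"
    using crit_lam_surj[of lam theta3_star] assms theta3_star_root crit_lam_theta3_star by metis
  show ?thesis
  proof (rule ex1I[of _ x])
    show "x \<in> {0<..<2 * pi} \<and> theta3_lhs lam x = 0"
      using x theta3_star_root by (simp add: theta3_lhs_zero_iff)
    fix y assume y: "y \<in> {0<..<2 * pi} \<and> theta3_lhs lam y = 0"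
    then have "crit_lam y = crit_lam x" using theta3_lhs_zero_iff[of y lam] x(3) by simp
    then show "y = x"
      by (rule strict_mono_on_eqD[OF crit_lam_mono, symmetric]) (use x(1,2) y theta3_star_root(2) in auto)
  qed
qed

lemma theta3_root:
  assumes "3 / 8 < lam" "lam \<le> lam_star"
  shows "0 < theta3 lam" "theta3 lam < 2 * pi" "crit_lam (theta3 lam) = lam"
proof -
  have "theta3 lam \<in> {0<..<2 * pi} \<and> theta3_lhs lam (theta3 lam) = 0"
    using theI'[OF ex1_theta3[OF assms]] assms by (simp add: theta3_def)
  then show "0 < theta3 lam" "theta3 lam < 2 * pi" "crit_lam (theta3 lam) = lam"
    by (auto simp: theta3_lhs_zero_iff)
qed

lemma theta3_lam_star: "theta3 lam_star = theta3_star"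
  using theta3_root[of lam_star] lam_star_bounds theta3_star_root crit_lam_theta3_star
    strict_mono_on_eqD[OF crit_lam_mono, of "theta3 lam_star" theta3_star] by auto

text \<open>\<open>theta3 lam\<close> does not exceed \<open>theta3_star\<close> since
  \<open>crit_lam\<close> increases, while \<open>im_quot\<close> decreases. Thus at the maximiser
  the second coordinate lies above every admissible parameter, which makes \<open>q3\<close>
  decrease.\<close>

lemma lam_star_le_im_quot_theta3:
  assumes "3 / 8 < lam" "lam \<le> lam_star"
  shows "lam_star \<le> im_quot (theta3 lam)"
proof -
  have "theta3 lam \<le> theta3_star"
  proof (rule ccontr)
    assume "\<not> theta3 lam \<le> theta3_star"
    then have "crit_lam theta3_star < crit_lam (theta3 lam)"
      using theta3_root[OF assms] theta3_star_root by (intro strict_mono_onD[OF crit_lam_mono]) auto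
    then show False using theta3_root[OF assms] assms crit_lam_theta3_star by simp
  qed
  then show ?thesis
    using im_quot_antimono[of "theta3 lam" theta3_star] theta3_root[OF assms]
    by (cases "theta3 lam = theta3_star") (auto simp: lam_star_eq)
qed

lemma dev_le_theta3:
  assumes lam: "3 / 8 < lam" "lam \<le> lam_star" and y: "0 < y"
  shows "dev lam y \<le> dev lam (theta3 lam)"
proof -
  note t = theta3_root[OF lam]
  have inner: "dev lam y \<le> dev lam (theta3 lam)" if "0 < y" "y < 2 * pi" for y
    using dev_le_of_le[of lam "theta3 lam" y] dev_le_of_ge[of "theta3 lam" lam y] t that
    by (cases "y \<le> theta3 lam") auto
  show ?thesis
  proof (cases "y < 2 * pi")
    case True
    then show ?thesis using inner y by blast
  next
    case False
    then have "dev lam y \<le> 0.35"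
      using lam lam_star_bounds pi_gt3 by (intro dev_le_tail) auto
    \<comment> \<open>As \<open>theta3 lam\<close> is known only implicitly, the comparison goes
      through \<open>theta3_star\<close>, where \<open>re_quot\<close> has a numerical
      bound.\<close>
    also have "0.35 \<le> (0.594971 :: real)\<^sup>2" by (simp add: power2_eq_square)
    also have "\<dots> \<le> (re_quot theta3_star)\<^sup>2"
      using re_quot_theta3_star_bounds by (intro power_mono) auto
    also have "\<dots> \<le> dev lam theta3_star" by (simp add: dev_def)
    also have "\<dots> \<le> dev lam (theta3 lam)" using inner theta3_star_root by blast
    finally show ?thesis .
  qed
qed

lemma dev_nonneg: "0 \<le> dev lam x"
  by (simp add: dev_def)

lemma q3_eq_theta3:
  assumes "3 / 8 < lam" "lam \<le> lam_star"
  shows "q3 lam = sqrt (dev lam (theta3 lam))"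
proof (rule antisym)
  show "q3 lam \<le> sqrt (dev lam (theta3 lam))"
    using dev_le_theta3[OF assms] by (intro q3_le) (auto simp: dev_nonneg)
  show "sqrt (dev lam (theta3 lam)) \<le> q3 lam"
    using theta3_root(1)[OF assms] by (rule sqrt_dev_le_q3)
qed

section \<open>Monotonicity in the parameter\<close>

lemma sin_less_self:
  fixes x :: real
  assumes "0 < x"
  shows "sin x < x"
proof (cases "x < pi")
  case True
  have c: "cos (x / 2) < cos 0" using True assms by (intro cos_monotone_0_pi) auto
  have s: "0 < sin (x / 2)" "sin (x / 2) \<le> x / 2"
    using True assms sin_gt_zero[of "x / 2"] sin_x_le_x[of "x / 2"] by auto
  have "sin x = 2 * (sin (x / 2) * cos (x / 2))" using sin_double[of "x / 2"] by simp
  also have "sin (x / 2) * cos (x / 2) < sin (x / 2) * 1"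
    using c s by (intro mult_strict_left_mono) auto
  finally show ?thesis using s by simp
next
  case False
  then show ?thesis using sin_le_one[of x] pi_gt3 by linarith
qed

lemma re_quot_pos:
  assumes "0 < x"
  shows "0 < re_quot x"
proof -
  have "cos 0 + 0\<^sup>2 / 2 < cos x + x\<^sup>2 / 2"
  proof (rule DERIV_pos_imp_increasing_open[OF assms])
    fix y :: real assume y: "0 < y" "y < x"
    have "((\<lambda>x. cos x + x\<^sup>2 / 2) has_real_derivative y - sin y) (at y)"
      by (auto intro!: derivative_eq_intros)
    then show "\<exists>d. ((\<lambda>x. cos x + x\<^sup>2 / 2) has_real_derivative d) (at y) \<and> 0 < d"
      using sin_less_self[of y] y by (intro exI conjI) (assumption, simp)
  qed (auto intro!: continuous_intros)
  then show ?thesis using assms by (simp add: re_quot_def)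
qed

text \<open>The triangle inequality for \<open>(0, lam)\<close>, \<open>(0, mu)\<close> and the
  point \<open>(re_quot x, im_quot x)\<close> at the maximiser \<open>x\<close> for
  \<open>lam\<close>. It is strict because \<open>re_quot x > 0\<close> keeps that point off the
  axis.\<close>

lemma q3_plus_mono: "strict_mono_on {3/8<..lam_star} (\<lambda>lam. lam + q3 lam)"
proof (rule strict_mono_onI)
  fix lam mu assume h: "lam \<in> {3/8<..lam_star}" "mu \<in> {3/8<..lam_star}" "lam < mu"
  define x where "x = theta3 lam"
  have x: "0 < x" using theta3_root h by (simp add: x_def)
  define r where "r = re_quot x"
  have r: "0 < r" using re_quot_pos[OF x] by (simp add: r_def)
  define s where "s = sqrt (dev mu x)"
  have s: "0 \<le> s" "s\<^sup>2 = r\<^sup>2 + (im_quot x - mu)\<^sup>2"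
    by (simp_all add: s_def dev_def r_def)
  have "dev lam x < (s + (mu - lam))\<^sup>2"
  proof -
    have "\<bar>im_quot x - mu\<bar> < s"
      by (rule power2_less_imp_less) (use s r in simp_all)
    then have "(im_quot x - mu) * (mu - lam) < s * (mu - lam)"
      using h by (intro mult_strict_right_mono) auto
    moreover have "dev lam x = s\<^sup>2 + 2 * ((im_quot x - mu) * (mu - lam)) + (mu - lam)\<^sup>2"
      unfolding s(2) dev_def r_def by algebra
    moreover have "(s + (mu - lam))\<^sup>2 = s\<^sup>2 + 2 * (s * (mu - lam)) + (mu - lam)\<^sup>2"
      by algebra
    ultimately show ?thesis by linarith
  qed
  then have "sqrt (dev lam x) < s + (mu - lam)"
    using s h by (intro real_less_lsqrt) auto
  then show "lam + q3 lam < mu + q3 mu"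
    using q3_eq_theta3[of lam] h sqrt_dev_le_q3[OF x, of mu]
    unfolding x_def[symmetric] s_def[symmetric] by simp
qed

lemma q3_antimono: "strict_antimono_on {0..lam_star} q3"
proof (rule monotone_onI)
  fix lam mu assume h: "lam \<in> {0..lam_star}" "mu \<in> {0..lam_star}" "lam < mu"
  show "q3 mu < q3 lam"
  proof (cases "mu \<le> 3 / 8")
    case True
    then show ?thesis using h by (simp add: q3_small)
  next
    case False
    then have mu: "3 / 8 < mu" "mu \<le> lam_star" using h by auto
    \<comment> \<open>The maximiser for \<open>mu\<close> serves as a test point for
      \<open>lam\<close>: with \<open>lam < mu <= im_quot (theta3 mu)\<close>, lowering the
      parameter increases the distance.\<close>
    have "(im_quot (theta3 mu) - mu)\<^sup>2 < (im_quot (theta3 mu) - lam)\<^sup>2"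
      using lam_star_le_im_quot_theta3[OF mu] mu h by (intro power_strict_mono) auto
    then have "sqrt (dev mu (theta3 mu)) < sqrt (dev lam (theta3 mu))"
      by (simp add: dev_def)
    also have "\<dots> \<le> q3 lam" using theta3_root(1)[OF mu] by (rule sqrt_dev_le_q3)
    finally show ?thesis using q3_eq_theta3[OF mu] by simp
  qed
qed

section \<open>The infimum of \<open>q3\<close> and the value of \<open>kappa3\<close>\<close>

lemma q3_lam_star: "q3 lam_star = re_quot theta3_star"
  using q3_eq_theta3[of lam_star] lam_star_bounds re_quot_theta3_star_bounds
  by (simp add: theta3_lam_star dev_def flip: lam_star_eq)

text \<open>Used in two ways together with \<open>q3_lam_star\<close>: fixing
  \<open>x = theta3_star\<close> and varying \<open>lam\<close> gives the infimum, while fixing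
  \<open>lam = lam_star\<close> and varying \<open>x\<close> gives \<open>kappa3\<close>.\<close>

lemma re_quot_le_q3:
  assumes "0 < x"
  shows "re_quot x \<le> q3 lam"
proof -
  have "re_quot x \<le> sqrt (dev lam x)" by (simp add: dev_def real_le_rsqrt)
  also have "\<dots> \<le> q3 lam" using assms by (rule sqrt_dev_le_q3)
  finally show ?thesis .
qed

lemma INF_q3: "(INF lam\<in>{0..}. q3 lam) = q3 lam_star"
proof (rule cInf_eq_minimum)
  show "q3 lam_star \<in> q3 ` {0..}" using lam_star_bounds by simp
  fix y assume "y \<in> q3 ` {0..}"
  then show "q3 lam_star \<le> y"
    using re_quot_le_q3[OF theta3_star_root(1)] by (auto simp: q3_lam_star)
qed

lemma kappa3_eq: "6 * kappa3 = re_quot theta3_star"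
proof -
  \<comment> \<open>At \<open>x = 0\<close> both sides are 0 by the convention for division by zero,
    so the equation can be used for rewriting under the supremum.\<close>
  have eq: "(cos x - 1 + x ^ 2 / 2) / x ^ 3 = re_quot x / 6" for x
    unfolding re_quot_def by (cases "x = 0") (simp_all add: field_simps)
  have "kappa3 = re_quot theta3_star / 6"
    unfolding kappa3_def eq
  proof (rule cSup_eq_maximum)
    show "re_quot theta3_star / 6 \<in> (\<lambda>x. re_quot x / 6) ` {0<..}"
      using theta3_star_root(1) by simp
    fix y assume "y \<in> (\<lambda>x. re_quot x / 6) ` {0<..}"
    then show "y \<le> re_quot theta3_star / 6"
      using re_quot_le_q3[of _ lam_star] by (auto simp: q3_lam_star)
  qed
  then show ?thesis by simp
qed

theorem lemma2:
  shows "0.4466 \<le> lam_star \<and> lam_star < 0.4467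
    \<and> (\<forall>lam\<in>{3/8<..lam_star}. \<exists>!x. x \<in> {0<..<2 * pi} \<and> theta3_lhs lam x = 0)
    \<and> theta3 lam_star = theta3_star
    \<and> (\<forall>lam\<in>{0..3/8}. q3 lam = 1 - lam)
    \<and> (\<forall>lam\<in>{3/8<..lam_star}.
         let x = theta3 lam in
         q3 lam = 6 / x ^ 3 *
           sqrt ((cos x - 1 + x ^ 2 / 2) ^ 2 + (sin x - x + lam * x ^ 3 / 6) ^ 2))
    \<and> strict_mono_on {3/8<..lam_star} (\<lambda>lam. lam + q3 lam)
    \<and> strict_antimono_on {0..lam_star} q3
    \<and> q3 (3/8) = 5/8
    \<and> (INF lam\<in>{0..}. q3 lam) = q3 lam_star
    \<and> q3 lam_star = 6 * kappa3
    \<and> 0.594971 \<le> 6 * kappa3 \<and> 6 * kappa3 < 0.594972"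
proof (intro conjI)
  show "\<forall>lam\<in>{3/8<..lam_star}. \<exists>!x. x \<in> {0<..<2 * pi} \<and> theta3_lhs lam x = 0"
    using ex1_theta3 by simp
  show "\<forall>lam\<in>{0..3/8}. q3 lam = 1 - lam"
    by (simp add: q3_small)
  show "\<forall>lam\<in>{3/8<..lam_star}.
      let x = theta3 lam in
      q3 lam = 6 / x ^ 3 *
        sqrt ((cos x - 1 + x ^ 2 / 2) ^ 2 + (sin x - x + lam * x ^ 3 / 6) ^ 2)"
    unfolding Let_def
  proof
    fix lam assume "lam \<in> {3/8<..lam_star}"
    then have lam: "3 / 8 < lam" "lam \<le> lam_star" by auto
    show "q3 lam = 6 / theta3 lam ^ 3 *
        sqrt ((cos (theta3 lam) - 1 + theta3 lam ^ 2 / 2) ^ 2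
          + (sin (theta3 lam) - theta3 lam + lam * theta3 lam ^ 3 / 6) ^ 2)"
      unfolding sqrt_dev[OF theta3_root(1)[OF lam]] by (rule q3_eq_theta3[OF lam])
  qed
  show "q3 (3/8) = 5/8"
    by (simp add: q3_small)
  show "q3 lam_star = 6 * kappa3"
    by (simp only: q3_lam_star kappa3_eq)
qed (unfold kappa3_eq, (rule lam_star_bounds theta3_lam_star q3_plus_mono q3_antimono INF_q3
      re_quot_theta3_star_bounds)+)

end
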